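(* For the star graphs $S_n$ and $S_m$ with positive integers $n,m$, the line graph $L(S_n\square S_m)$ of their Cartesian product satisfies $\varphi(L(S_n\square S_m))=m+n$.
   Context: All graphs are finite, simple, undirected and connected. The star graph $S_n$ has $n+1$ vertices: a central vertex adjacent to each of $n$ other vertices, and no two of these $n$ vertices are adjacent (so $S_n=K_{1,n}$). The Cartesian product $G\square H$ has vertex set $V(G)\times V(H)$, with $(u,v)$ and $(u',v')$ adjacent if and only if either $v=v'$ and $u\sim u'$ in $G$, or $u=u'$ and $v\sim v'$ in $H$. The line graph $L(G)$ has one vertex for each edge of $G$, two being adjacent if and only if the corresponding distinct edges share an endpoint in $G$. In a proper coloring of $G$ with $k$ colors, a vertex of color $i$ is a $b$-vertex if for each color $j\ne i$ it is adjacent to at least one vertex of color $j$; a proper coloring is a $b$-coloring if every one of its colors $i\in\{1,\dots,k\}$ has at least one $b$-vertex of color $i$. The $b$-chromatic number $\varphi(G)$ is the largest integer $k$ such that $G$ has a $b$-coloring with $k$ colors. *)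

theory Defs
  imports Main
begin

record 'a ugraph =
  verts :: "'a set"
  edges :: "'a set set"

definition simple_graph :: "'a ugraph \<Rightarrow> bool" where
  "simple_graph G \<longleftrightarrow> finite (verts G) \<and> (\<forall>e \<in> edges G. e \<subseteq> verts G \<and> card e = 2)"

definition adj :: "'a ugraph \<Rightarrow> 'a \<Rightarrow> 'a \<Rightarrow> bool" where
  "adj G u v \<longleftrightarrow> {u, v} \<in> edges G"

text \<open>The centre of the star is the vertex 0, its leaves are 1, ..., n.\<close>

definition star_graph :: "nat \<Rightarrow> nat ugraph" where
  "star_graph n = \<lparr>verts = {0..n}, edges = {{0, i} | i. i \<in> {1..n}}\<rparr>"

definition cartesian_product :: "'a ugraph \<Rightarrow> 'b ugraph \<Rightarrow> ('a \<times> 'b) ugraph" where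
  "cartesian_product G H =
     \<lparr>verts = verts G \<times> verts H,
      edges = {{(u, v), (u', v')} | u v u' v'.
         u \<in> verts G \<and> u' \<in> verts G \<and> v \<in> verts H \<and> v' \<in> verts H \<and>
         (v = v' \<and> adj G u u' \<or> u = u' \<and> adj H v v')}\<rparr>"

definition line_graph :: "'a ugraph \<Rightarrow> 'a set ugraph" where
  "line_graph G =
     \<lparr>verts = edges G,
      edges = {{e, f} | e f. e \<in> edges G \<and> f \<in> edges G \<and> e \<noteq> f \<and> e \<inter> f \<noteq> {}}\<rparr>"

definition proper_coloring :: "'a ugraph \<Rightarrow> nat \<Rightarrow> ('a \<Rightarrow> nat) \<Rightarrow> bool" where
  "proper_coloring G k c \<longleftrightarrow>
     (\<forall>v \<in> verts G. c v \<in> {1..k}) \<and>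
     (\<forall>u \<in> verts G. \<forall>v \<in> verts G. adj G u v \<longrightarrow> c u \<noteq> c v)"

definition b_vertex :: "'a ugraph \<Rightarrow> nat \<Rightarrow> ('a \<Rightarrow> nat) \<Rightarrow> 'a \<Rightarrow> bool" where
  "b_vertex G k c v \<longleftrightarrow>
     v \<in> verts G \<and> (\<forall>j \<in> {1..k}. j \<noteq> c v \<longrightarrow> (\<exists>w \<in> verts G. adj G v w \<and> c w = j))"

definition b_coloring :: "'a ugraph \<Rightarrow> nat \<Rightarrow> ('a \<Rightarrow> nat) \<Rightarrow> bool" where
  "b_coloring G k c \<longleftrightarrow>
     proper_coloring G k c \<and> (\<forall>i \<in> {1..k}. \<exists>v. b_vertex G k c v \<and> c v = i)"

text \<open>For a finite graph the numbers of colours of its b-colorings are bounded by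
  the number of vertices (lemma \<open>b_coloring_le_card\<close> below).\<close>

definition b_chromatic_number :: "'a ugraph \<Rightarrow> nat" where
  "b_chromatic_number G = (GREATEST k. \<exists>c. b_coloring G k c)"

lemma simple_graph_star_graph: "simple_graph (star_graph n)"
  by (auto simp: simple_graph_def star_graph_def)

lemma simple_graph_cartesian_product:
  assumes "simple_graph G" "simple_graph H"
  shows "simple_graph (cartesian_product G H)"
proof -
  have "u \<noteq> u'" if "adj G u u'" for u u'
    using assms(1) that by (auto simp: simple_graph_def adj_def)
  moreover have "v \<noteq> v'" if "adj H v v'" for v v'
    using assms(2) that by (auto simp: simple_graph_def adj_def)
  ultimately show ?thesis
    using assms by (fastforce simp: simple_graph_def cartesian_product_def card_2_iff)
qed

lemma simple_graph_line_graph: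
  assumes "simple_graph G"
  shows "simple_graph (line_graph G)"
proof -
  have "edges G \<subseteq> Pow (verts G)"
    using assms by (auto simp: simple_graph_def)
  then have "finite (edges G)"
    using assms finite_subset by (auto simp: simple_graph_def)
  then show ?thesis
    by (auto simp: simple_graph_def line_graph_def card_2_iff)
qed

lemma b_coloring_le_card:
  assumes "simple_graph G" "b_coloring G k c"
  shows "k \<le> card (verts G)"
proof -
  have "{1..k} \<subseteq> c ` verts G"
    using assms(2) by (fastforce simp: b_coloring_def b_vertex_def)
  then have "card {1..k} \<le> card (verts G)"
    using assms(1) by (intro surj_card_le) (auto simp: simple_graph_def)
  then show ?thesis
    by simp
qed

end

theory Submission imports Defs
begin

text \<open>The \<open>n + m\<close> edges at the centre \<open>(0, 0)\<close> form a clique of the line graph. Colouring every edge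
  by its direction (the leaf of the first or of the second star that it belongs to) is proper and
  gives these edges all \<open>n + m\<close> colours, so each of them is a b-vertex.

  Conversely, suppose there are \<open>k > n + m\<close> colours. If \<open>n, m \<ge> 2\<close>, only edges at the centre have
  degree at least \<open>k - 1\<close> in the line graph, and there are too few of them. If \<open>n = 1\<close>, apart from
  the edge \<open>a\<close> joining the two centres, the b-vertices are (for degree reasons) among the edges
  \<open>b\<^sub>j\<close>, \<open>c\<^sub>j\<close> of the two copies of \<open>S\<^sub>m\<close>. There are at least \<open>m + 1\<close> colours other than that of \<open>a\<close>,
  so for some \<open>j\<close> both \<open>b\<^sub>j\<close> and \<open>c\<^sub>j\<close> are b-vertices. The colour of the rung \<open>d\<^sub>j\<close> is then missing
  from both copies of \<open>S\<^sub>m\<close>, and so has no b-vertex. The case \<open>m = 1\<close> is symmetric, and the 4-cycle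
  \<open>n = m = 1\<close> needs an extra argument because there the rung can be a b-vertex too.\<close>

section \<open>Edges of the product of two stars and their incidences\<close>

abbreviation hedge :: "nat \<Rightarrow> nat \<Rightarrow> (nat \<times> nat) set" where
  "hedge i y \<equiv> {(0, y), (i, y)}"

abbreviation vedge :: "nat \<Rightarrow> nat \<Rightarrow> (nat \<times> nat) set" where
  "vedge x j \<equiv> {(x, 0), (x, j)}"

lemma hedge_inter_hedge: "hedge i y \<inter> hedge i' y' \<noteq> {} \<longleftrightarrow> y = y'"
  by auto

lemma hedge_inter_vedge: "hedge i y \<inter> vedge x j \<noteq> {} \<longleftrightarrow> (x = 0 \<or> x = i) \<and> (y = 0 \<or> y = j)"
  by auto

lemma vedge_inter_hedge: "vedge x j \<inter> hedge i y \<noteq> {} \<longleftrightarrow> (x = 0 \<or> x = i) \<and> (y = 0 \<or> y = j)"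
  by auto

lemma vedge_inter_vedge: "vedge x j \<inter> vedge x' j' \<noteq> {} \<longleftrightarrow> x = x'"
  by auto

lemmas edge_inter = hedge_inter_hedge hedge_inter_vedge vedge_inter_hedge vedge_inter_vedge

lemma adj_star_graph:
  "adj (star_graph n) u v \<longleftrightarrow> (u = 0 \<and> v \<in> {1..n}) \<or> (v = 0 \<and> u \<in> {1..n})"
  by (auto simp: adj_def star_graph_def doubleton_eq_iff)

lemma verts_star_graph: "verts (star_graph n) = {0..n}"
  by (simp add: star_graph_def)

lemma edges_star_product:
  "edges (cartesian_product (star_graph n) (star_graph m)) =
     {hedge i y | i y. i \<in> {1..n} \<and> y \<in> {0..m}} \<union> {vedge x j | x j. x \<in> {0..n} \<and> j \<in> {1..m}}"
  (is "?L = ?R")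
proof
  show "?L \<subseteq> ?R"
    unfolding cartesian_product_def adj_star_graph verts_star_graph
    by (auto simp: insert_commute)
  show "?R \<subseteq> ?L"
  proof
    fix e assume "e \<in> ?R"
    then consider i y where "e = hedge i y" "i \<in> {1..n}" "y \<in> {0..m}"
      | x j where "e = vedge x j" "x \<in> {0..n}" "j \<in> {1..m}" by blast
    then show "e \<in> ?L"
    proof cases
      case 1
      then show ?thesis unfolding cartesian_product_def adj_star_graph verts_star_graph
        by simp (intro exI[of _ 0] exI[of _ y] exI[of _ i], simp)
    next
      case 2
      then show ?thesis unfolding cartesian_product_def adj_star_graph verts_star_graph
        by simp (intro exI[of _ x] exI[of _ 0] exI[of _ x] exI[of _ j], simp)
    qed
  qed
qed

lemma hedge_in_edges:
  "i \<in> {1..n} \<Longrightarrow> y \<le> m \<Longrightarrow> hedge i y \<in> edges (cartesian_product (star_graph n) (star_graph m))"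
  unfolding edges_star_product by (intro UnI1 CollectI exI[of _ i] exI[of _ y]) simp

lemma vedge_in_edges:
  "x \<le> n \<Longrightarrow> j \<in> {1..m} \<Longrightarrow> vedge x j \<in> edges (cartesian_product (star_graph n) (star_graph m))"
  unfolding edges_star_product by (intro UnI2 CollectI exI[of _ x] exI[of _ j]) simp

lemma adj_line_graph:
  "adj (line_graph G) e f \<longleftrightarrow> e \<in> edges G \<and> f \<in> edges G \<and> e \<noteq> f \<and> e \<inter> f \<noteq> {}"
  by (auto simp: adj_def line_graph_def doubleton_eq_iff)

lemma verts_line_graph: "verts (line_graph G) = edges G"
  by (simp add: line_graph_def)

text \<open>A nonempty \<open>e\<close> meets itself, so the edges meeting \<open>e\<close> form its
  closed neighbourhood and contribute the colour of \<open>e\<close> as well.\<close>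

lemma b_vertex_line_graph_colours:
  assumes "b_vertex (line_graph G) k c e" "e \<noteq> {}"
  shows "{1..k} \<subseteq> c ` {f \<in> edges G. e \<inter> f \<noteq> {}}"
  using assms unfolding b_vertex_def verts_line_graph adj_line_graph
  by (fastforce simp del: atLeastAtMost_iff)

section \<open>Closed neighbourhoods in the line graph\<close>

context
  fixes n m :: nat and E :: "(nat \<times> nat) set set"
  defines "E \<equiv> edges (cartesian_product (star_graph n) (star_graph m))"
begin

text \<open>The first and third cases are the edges at the centre \<open>(0, 0)\<close>; the other
  two avoid it.\<close>

lemma star_product_edge_cases:
  assumes "e \<in> E"
  obtains i where "i \<in> {1..n}" "e = hedge i 0"
  | i j where "i \<in> {1..n}" "j \<in> {1..m}" "e = hedge i j"
  | j where "j \<in> {1..m}" "e = vedge 0 j"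
  | i j where "i \<in> {1..n}" "j \<in> {1..m}" "e = vedge i j"
proof -
  consider i y where "e = hedge i y" "i \<in> {1..n}" "y \<in> {0..m}"
    | x j where "e = vedge x j" "x \<in> {0..n}" "j \<in> {1..m}"
    using assms unfolding E_def edges_star_product by blast
  then show thesis
  proof cases
    case 1
    then show thesis using that(1)[of i] that(2)[of i y] by (cases "y = 0") auto
  next
    case 2
    then show thesis using that(3)[of j] that(4)[of x j] by (cases "x = 0") auto
  qed
qed

text \<open>This and the next three inclusions bound the closed neighbourhoods by
  \<open>n + 2 * m\<close>, \<open>n + 2\<close>, \<open>m + 2 * n\<close> and \<open>m + 2\<close>
  edges.\<close>

lemma meets_hedge_0:
  assumes "i \<in> {1..n}"
  shows "{f \<in> E. hedge i 0 \<inter> f \<noteq> {}} \<subseteq>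
    (\<lambda>i. hedge i 0) ` {1..n} \<union> vedge 0 ` {1..m} \<union> vedge i ` {1..m}"
proof
  fix f assume "f \<in> {f \<in> E. hedge i 0 \<inter> f \<noteq> {}}"
  then have f: "f \<in> E" "hedge i 0 \<inter> f \<noteq> {}" by simp_all
  from f(1) show "f \<in> (\<lambda>i. hedge i 0) ` {1..n} \<union> vedge 0 ` {1..m} \<union> vedge i ` {1..m}"
    by (cases rule: star_product_edge_cases; use assms f(2) in \<open>simp only: edge_inter\<close>; fastforce?)
qed

lemma meets_hedge:
  assumes "i \<in> {1..n}" "j \<in> {1..m}"
  shows "{f \<in> E. hedge i j \<inter> f \<noteq> {}} \<subseteq>
    (\<lambda>i. hedge i j) ` {1..n} \<union> {vedge 0 j, vedge i j}"
proof
  fix f assume "f \<in> {f \<in> E. hedge i j \<inter> f \<noteq> {}}"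
  then have f: "f \<in> E" "hedge i j \<inter> f \<noteq> {}" by simp_all
  from f(1) show "f \<in> (\<lambda>i. hedge i j) ` {1..n} \<union> {vedge 0 j, vedge i j}"
    by (cases rule: star_product_edge_cases; use assms f(2) in \<open>simp only: edge_inter\<close>; fastforce?)
qed

lemma meets_vedge_0:
  assumes "j \<in> {1..m}"
  shows "{f \<in> E. vedge 0 j \<inter> f \<noteq> {}} \<subseteq>
    vedge 0 ` {1..m} \<union> (\<lambda>i. hedge i 0) ` {1..n} \<union> (\<lambda>i. hedge i j) ` {1..n}"
proof
  fix f assume "f \<in> {f \<in> E. vedge 0 j \<inter> f \<noteq> {}}"
  then have f: "f \<in> E" "vedge 0 j \<inter> f \<noteq> {}" by simp_all
  from f(1) show "f \<in> vedge 0 ` {1..m} \<union> (\<lambda>i. hedge i 0) ` {1..n} \<union> (\<lambda>i. hedge i j) ` {1..n}"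
    by (cases rule: star_product_edge_cases; use assms f(2) in \<open>simp only: edge_inter\<close>; fastforce?)
qed

lemma meets_vedge:
  assumes "i \<in> {1..n}" "j \<in> {1..m}"
  shows "{f \<in> E. vedge i j \<inter> f \<noteq> {}} \<subseteq> vedge i ` {1..m} \<union> {hedge i 0, hedge i j}"
proof
  fix f assume "f \<in> {f \<in> E. vedge i j \<inter> f \<noteq> {}}"
  then have f: "f \<in> E" "vedge i j \<inter> f \<noteq> {}" by simp_all
  from f(1) show "f \<in> vedge i ` {1..m} \<union> {hedge i 0, hedge i j}"
    by (cases rule: star_product_edge_cases; use assms f(2) in \<open>simp only: edge_inter\<close>; fastforce?)
qed

end

section \<open>Lower bound: a b-coloring with \<open>m + n\<close> colours\<close>

text \<open>A constant second coordinate identifies a \<open>hedge\<close>. As the centre of each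
  star is 0, \<open>Max\<close> extracts the leaf; the shift by \<open>n\<close> separates the two
  stars.\<close>

definition direction_colour :: "nat \<Rightarrow> (nat \<times> nat) set \<Rightarrow> nat" where
  "direction_colour n e = (if is_singleton (snd ` e) then Max (fst ` e) else n + Max (snd ` e))"

lemma direction_colour_hedge: "direction_colour n (hedge i y) = i"
  by (simp add: direction_colour_def)

lemma direction_colour_vedge: "j \<ge> 1 \<Longrightarrow> direction_colour n (vedge x j) = n + j"
  by (auto simp: direction_colour_def is_singleton_def)

lemma b_coloring_direction_colour:
  "b_coloring (line_graph (cartesian_product (star_graph n) (star_graph m))) (m + n)
     (direction_colour n)" (is "b_coloring (line_graph ?G) _ ?c")
proof -
  have range: "?c e \<in> {1..m + n}" if "e \<in> edges ?G" for e
    using that by (cases rule: star_product_edge_cases)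
      (auto simp: direction_colour_hedge direction_colour_vedge)
  \<comment> \<open>Distinct edges of one colour are parallel copies of the same star edge, hence
    disjoint.\<close>
  have proper: "?c e \<noteq> ?c f" if "e \<in> edges ?G" "f \<in> edges ?G" "e \<noteq> f" "e \<inter> f \<noteq> {}" for e f
    using that(1)
  proof (cases rule: star_product_edge_cases)
    case (1 i)
    with that(2-4) show ?thesis
      by (cases rule: star_product_edge_cases[OF that(2)])
        (auto simp: direction_colour_hedge direction_colour_vedge)
  next
    case (2 i j)
    with that(2-4) show ?thesis
      by (cases rule: star_product_edge_cases[OF that(2)])
        (auto simp: direction_colour_hedge direction_colour_vedge)
  next
    case (3 j)
    with that(2-4) show ?thesis
      by (cases rule: star_product_edge_cases[OF that(2)])
        (auto simp: direction_colour_hedge direction_colour_vedge)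
  next
    case (4 i j)
    with that(2-4) show ?thesis
      by (cases rule: star_product_edge_cases[OF that(2)])
        (auto simp: direction_colour_hedge direction_colour_vedge)
  qed
  have centre: "\<exists>e \<in> edges ?G. (0, 0) \<in> e \<and> ?c e = i" if "i \<in> {1..m + n}" for i
  proof (cases "i \<le> n")
    case True
    then show ?thesis using that
      by (intro bexI[of _ "hedge i 0"] hedge_in_edges) (auto simp: direction_colour_hedge)
  next
    case False
    then show ?thesis using that
      by (intro bexI[of _ "vedge 0 (i - n)"] vedge_in_edges) (auto simp: direction_colour_vedge)
  qed
  have "b_vertex (line_graph ?G) (m + n) ?c e" if "e \<in> edges ?G" "(0, 0) \<in> e" for e
    unfolding b_vertex_def verts_line_graph adj_line_graph
  proof (intro conjI ballI impI)
    \<comment> \<open>The edge of colour \<open>j\<close> at \<open>(0, 0)\<close> meets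
      \<open>e\<close> there and differs from \<open>e\<close> because its colour does.\<close>
    fix j assume "j \<in> {1..m + n}" "j \<noteq> ?c e"
    with centre that show "\<exists>f\<in>edges ?G. (e \<in> edges ?G \<and> f \<in> edges ?G \<and> e \<noteq> f \<and> e \<inter> f \<noteq> {}) \<and> ?c f = j"
      by blast
  qed (rule that)
  with range proper centre show ?thesis
    unfolding b_coloring_def proper_coloring_def verts_line_graph adj_line_graph by blast
qed

section \<open>Upper bound on the number of colours\<close>

text \<open>Colours in the line graph of \<open>S\<^sub>1 \<box> S\<^sub>m\<close>: \<open>a\<close> on the edge joining the centres, \<open>B j\<close> and \<open>C j\<close>
  on the two copies of the \<open>j\<close>-th edge of \<open>S\<^sub>m\<close>, and \<open>D j\<close> on the rung joining them.\<close>

lemma colours_le_of_star_prism: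
  fixes B C D :: "nat \<Rightarrow> nat"
  assumes a: "a \<in> {1..k}" "\<And>j. j \<in> {1..m} \<Longrightarrow> a \<noteq> B j \<and> a \<noteq> C j"
    and B: "\<And>j. j \<in> {1..m} \<Longrightarrow> B j \<in> {1..k}"
    and m: "m \<ge> 1"
    and dominating: "\<And>i. i \<in> {1..k} \<Longrightarrow> i \<noteq> a \<Longrightarrow> \<exists>j\<in>{1..m}.
        B j = i \<and> {1..k} \<subseteq> B ` {1..m} \<union> {a, D j} \<or>
        C j = i \<and> {1..k} \<subseteq> C ` {1..m} \<union> {a, D j} \<or>
        D j = i \<and> {1..k} \<subseteq> {D j, B j, C j}"
  shows "k \<le> m + 1"
proof (rule ccontr)
  assume "\<not> k \<le> m + 1"
  then have k: "k \<ge> m + 2" by simp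
  have not_subset: "\<not> {1..k} \<subseteq> insert a (F ` {1..m})" for F
  proof
    assume "{1..k} \<subseteq> insert a (F ` {1..m})"
    then have "k \<le> card (insert a (F ` {1..m}))"
      using card_mono[of "insert a (F ` {1..m})" "{1..k}"] by simp
    also have "\<dots> \<le> Suc (card (F ` {1..m}))"
      by (rule card_insert_le_m1) auto
    also have "\<dots> \<le> Suc m"
      using card_image_le[of "{1..m}" F] by simp
    finally show False using k by simp
  qed
  have rung: "\<not> {1..k} \<subseteq> {D j, B j, C j}" if j: "j \<in> {1..m}" for j
  proof
    assume sub: "{1..k} \<subseteq> {D j, B j, C j}"
    then have "k \<le> card {D j, B j, C j}"
      using card_mono[of "{D j, B j, C j}" "{1..k}"] by simp
    also have "\<dots> \<le> 3" by (simp add: card_insert_if)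
    \<comment> \<open>Only the 4-cycle leaves room for a rung as b-vertex:
      \<open>m + 2 \<le> k \<le> 3\<close>.\<close>
    finally have "m = 1" using k m by simp
    with j have "j = 1" by simp
    \<comment> \<open>The three colours must include \<open>a\<close>, which differs from
      \<open>B j\<close> and \<open>C j\<close>.\<close>
    have aD: "a = D j" using sub a j by blast
    \<comment> \<open>A colour other than \<open>a\<close> is now not that of the rung, so one of
      the first two alternatives of \<open>dominating\<close> applies, with \<open>D j\<close>
      absorbed by \<open>a\<close>.\<close>
    have "i = a \<or> {1..k} \<subseteq> insert a (B ` {1..m}) \<or> {1..k} \<subseteq> insert a (C ` {1..m})"
      if "i \<in> {1..k}" for i
      using dominating[OF that] aD \<open>m = 1\<close> \<open>j = 1\<close> by auto
    with not_subset have "{1..k} \<subseteq> {a}" by blast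
    with not_subset[of B] show False by blast
  qed
  define good where "good F j \<longleftrightarrow> {1..k} \<subseteq> F ` {1..m} \<union> {a, D j}" for F :: "nat \<Rightarrow> nat" and j
  have "\<forall>i \<in> {1..k} - {a}. \<exists>j. j \<in> {1..m} \<and> (B j = i \<and> good B j \<or> C j = i \<and> good C j)"
    using dominating rung unfolding good_def by blast
  then obtain J where J: "\<And>i. i \<in> {1..k} - {a} \<Longrightarrow>
      J i \<in> {1..m} \<and> (B (J i) = i \<and> good B (J i) \<or> C (J i) = i \<and> good C (J i))"
    by metis
  \<comment> \<open>Pigeonhole: at least \<open>m + 1\<close> colours other than \<open>a\<close>
    are sent to \<open>m\<close> indices.\<close>
  have "card (J ` ({1..k} - {a})) \<le> m"
    using card_mono[of "{1..m}" "J ` ({1..k} - {a})"] J by fastforce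
  moreover have "card ({1..k} - {a}) > m" using a(1) k by simp
  ultimately have "\<not> inj_on J ({1..k} - {a})"
    using pigeonhole by (metis order.strict_trans1)
  then obtain i i' where i: "i \<in> {1..k} - {a}" "i' \<in> {1..k} - {a}" "J i = J i'" "i \<noteq> i'"
    unfolding inj_on_def by blast
  define j where "j = J i"
  \<comment> \<open>Distinct colours at the same index cannot both be \<open>B j\<close> or both be
    \<open>C j\<close>, so each copy supplies one of them.\<close>
  have good: "good B j" "good C j"
    using J[OF i(1)] J[OF i(2)] i(3,4) unfolding j_def by auto
  \<comment> \<open>Otherwise \<open>D j\<close> could be dropped from the cover given by
    \<open>good B j\<close>, contradicting \<open>not_subset\<close>.\<close>
  have new: "D j \<in> {1..k} - {a}" "D j \<notin> B ` {1..m}"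
    using good(1) not_subset[of B] unfolding good_def by blast+
  have "D j \<notin> C ` {1..m}"
    using good(2) not_subset[of C] unfolding good_def by blast
  \<comment> \<open>The colour \<open>D j\<close> would need a b-vertex in one of the two copies,
    but it occurs in neither.\<close>
  with new J[OF new(1)] show False by (metis imageI)
qed

lemma b_coloring_star_product_le:
  assumes "n \<ge> 1" "m \<ge> 1"
    and "b_coloring (line_graph (cartesian_product (star_graph n) (star_graph m))) k c"
      (is "b_coloring (line_graph ?G) k c")
  shows "k \<le> m + n"
proof -
  define N where "N e = {f \<in> edges ?G. e \<inter> f \<noteq> {}}" for e
  have range: "c e \<in> {1..k}" if "e \<in> edges ?G" for e
    using assms(3) that by (simp add: b_coloring_def proper_coloring_def verts_line_graph)
  have proper: "c e \<noteq> c f" if "e \<in> edges ?G" "f \<in> edges ?G" "e \<noteq> f" "e \<inter> f \<noteq> {}" for e f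
    using assms(3) that
    by (simp add: b_coloring_def proper_coloring_def verts_line_graph adj_line_graph)
  note H = hedge_in_edges[of _ n _ m] and V = vedge_in_edges[of _ n _ m]
  have dom: "\<exists>e. e \<in> edges ?G \<and> c e = i \<and> {1..k} \<subseteq> c ` N e" if "i \<in> {1..k}" for i
  proof -
    obtain e where e: "b_vertex (line_graph ?G) k c e" "c e = i"
      using assms(3) \<open>i \<in> {1..k}\<close> unfolding b_coloring_def by blast
    then have "e \<in> edges ?G" by (simp add: b_vertex_def verts_line_graph)
    moreover from this have "e \<noteq> {}" by (auto simp: edges_star_product)
    ultimately show ?thesis using e b_vertex_line_graph_colours unfolding N_def by blast
  qed
  have N_hedge_0: "c ` N (hedge i 0) \<subseteq> (\<lambda>i. c (hedge i 0)) ` {1..n} \<union>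
      (\<lambda>j. c (vedge 0 j)) ` {1..m} \<union> (\<lambda>j. c (vedge i j)) ` {1..m}" if "i \<in> {1..n}" for i
    using image_mono[OF meets_hedge_0[OF that, of m], of c] unfolding N_def image_Un image_image .
  have N_hedge: "c ` N (hedge i j) \<subseteq> (\<lambda>i. c (hedge i j)) ` {1..n} \<union> {c (vedge 0 j), c (vedge i j)}"
    if "i \<in> {1..n}" "j \<in> {1..m}" for i j
    using image_mono[OF meets_hedge[OF that], of c]
    unfolding N_def image_Un image_image image_insert image_empty .
  have N_vedge_0: "c ` N (vedge 0 j) \<subseteq> (\<lambda>j. c (vedge 0 j)) ` {1..m} \<union>
      (\<lambda>i. c (hedge i 0)) ` {1..n} \<union> (\<lambda>i. c (hedge i j)) ` {1..n}" if "j \<in> {1..m}" for j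
    using image_mono[OF meets_vedge_0[OF that, of n], of c] unfolding N_def image_Un image_image .
  have N_vedge: "c ` N (vedge i j) \<subseteq> (\<lambda>j. c (vedge i j)) ` {1..m} \<union> {c (hedge i 0), c (hedge i j)}"
    if "i \<in> {1..n}" "j \<in> {1..m}" for i j
    using image_mono[OF meets_vedge[OF that], of c]
    unfolding N_def image_Un image_image image_insert image_empty .
  \<comment> \<open>Applied to edges off the centre: parameter \<open>r\<close> is \<open>n\<close>
    for a \<open>hedge\<close> and \<open>m\<close> for a \<open>vedge\<close>, and
    \<open>x\<close>, \<open>y\<close> are the colours of the two crossing edges.\<close>
  have le: "k \<le> r + 2" if "{1..k} \<subseteq> F ` {1..r} \<union> {x, y}" for F :: "nat \<Rightarrow> nat" and r x y
  proof -
    have "k \<le> card (F ` {1..r} \<union> {x, y})"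
      using card_mono[OF _ that] by simp
    also have "\<dots> \<le> card (F ` {1..r}) + card {x, y}" by (rule card_Un_le)
    also have "\<dots> \<le> r + 2"
      using card_image_le[of "{1..r}" F] by (intro add_mono) (auto simp: card_insert_if)
    finally show ?thesis .
  qed
  consider "n = 1" | "m = 1" | "n \<ge> 2" "m \<ge> 2" using assms(1,2) by linarith
  then show ?thesis
  proof cases
    case 1
    have "k \<le> m + 1"
    proof (rule colours_le_of_star_prism[of "c (hedge 1 0)" k m "\<lambda>j. c (vedge 0 j)"
          "\<lambda>j. c (vedge 1 j)" "\<lambda>j. c (hedge 1 j)"])
      fix i assume i: "i \<in> {1..k}" "i \<noteq> c (hedge 1 0)"
      then obtain e where e: "e \<in> edges ?G" "c e = i" "{1..k} \<subseteq> c ` N e" using dom by blast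
      from e(1) show "\<exists>j\<in>{1..m}.
        c (vedge 0 j) = i \<and> {1..k} \<subseteq> (\<lambda>j. c (vedge 0 j)) ` {1..m} \<union> {c (hedge 1 0), c (hedge 1 j)} \<or>
        c (vedge 1 j) = i \<and> {1..k} \<subseteq> (\<lambda>j. c (vedge 1 j)) ` {1..m} \<union> {c (hedge 1 0), c (hedge 1 j)} \<or>
        c (hedge 1 j) = i \<and> {1..k} \<subseteq> {c (hedge 1 j), c (vedge 0 j), c (vedge 1 j)}"
      proof (cases rule: star_product_edge_cases)
        case (1 i')
        \<comment> \<open>Here \<open>e\<close> is the edge joining the two centres, whose colour
          was excluded.\<close>
        with i e \<open>n = 1\<close> show ?thesis by simp
      next
        case (2 i' j)
        then have "i' = 1" using \<open>n = 1\<close> by simp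
        moreover have "{1..k} \<subseteq> {c (hedge 1 j), c (vedge 0 j), c (vedge 1 j)}"
          using order.trans[OF e(3)[unfolded 2(3)] N_hedge[OF 2(1,2)]] \<open>n = 1\<close> \<open>i' = 1\<close> by auto
        ultimately show ?thesis using e(2) 2 by blast
      next
        case (3 j)
        have "{1..k} \<subseteq> (\<lambda>j. c (vedge 0 j)) ` {1..m} \<union> {c (hedge 1 0), c (hedge 1 j)}"
          using order.trans[OF e(3)[unfolded 3(2)] N_vedge_0[OF 3(1)]] \<open>n = 1\<close> by auto
        then show ?thesis using e(2) 3 by blast
      next
        case (4 i' j)
        then have "i' = 1" using \<open>n = 1\<close> by simp
        moreover have "{1..k} \<subseteq> (\<lambda>j. c (vedge 1 j)) ` {1..m} \<union> {c (hedge 1 0), c (hedge 1 j)}"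
          using order.trans[OF e(3)[unfolded 4(3)] N_vedge[OF 4(1,2)]] \<open>i' = 1\<close> by simp
        ultimately show ?thesis using e(2) 4 by blast
      qed
    next
      show "c (hedge 1 0) \<noteq> c (vedge 0 j) \<and> c (hedge 1 0) \<noteq> c (vedge 1 j)" if "j \<in> {1..m}" for j
        using that \<open>n = 1\<close> H[of 1 0] V[of 0 j] V[of 1 j]
        by (intro conjI proper) (auto simp: doubleton_eq_iff)
      show "c (hedge 1 0) \<in> {1..k}" using H[of 1 0] \<open>n = 1\<close> by (intro range) simp
      show "c (vedge 0 j) \<in> {1..k}" if "j \<in> {1..m}" for j
        using V[of 0 j] that by (intro range) simp
    qed (rule assms)
    with 1 show ?thesis by simp
  next
    case 2
    have "k \<le> n + 1"
    \<comment> \<open>The factors swap roles: \<open>vedge 0 1\<close> joins the centres and the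
      edges \<open>vedge i 1\<close> are the rungs.\<close>
    proof (rule colours_le_of_star_prism[of "c (vedge 0 1)" k n "\<lambda>i. c (hedge i 0)"
          "\<lambda>i. c (hedge i 1)" "\<lambda>i. c (vedge i 1)"])
      fix i assume i: "i \<in> {1..k}" "i \<noteq> c (vedge 0 1)"
      then obtain e where e: "e \<in> edges ?G" "c e = i" "{1..k} \<subseteq> c ` N e" using dom by blast
      from e(1) show "\<exists>j\<in>{1..n}.
        c (hedge j 0) = i \<and> {1..k} \<subseteq> (\<lambda>j. c (hedge j 0)) ` {1..n} \<union> {c (vedge 0 1), c (vedge j 1)} \<or>
        c (hedge j 1) = i \<and> {1..k} \<subseteq> (\<lambda>j. c (hedge j 1)) ` {1..n} \<union> {c (vedge 0 1), c (vedge j 1)} \<or>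
        c (vedge j 1) = i \<and> {1..k} \<subseteq> {c (vedge j 1), c (hedge j 0), c (hedge j 1)}"
      proof (cases rule: star_product_edge_cases)
        case (1 i')
        have "{1..k} \<subseteq> (\<lambda>j. c (hedge j 0)) ` {1..n} \<union> {c (vedge 0 1), c (vedge i' 1)}"
          using order.trans[OF e(3)[unfolded 1(2)] N_hedge_0[OF 1(1)]] \<open>m = 1\<close> by auto
        then show ?thesis using e(2) 1 by blast
      next
        case (2 i' j)
        then have "j = 1" using \<open>m = 1\<close> by simp
        moreover have "{1..k} \<subseteq> (\<lambda>j. c (hedge j 1)) ` {1..n} \<union> {c (vedge 0 1), c (vedge i' 1)}"
          using order.trans[OF e(3)[unfolded 2(3)] N_hedge[OF 2(1,2)]] \<open>j = 1\<close> by simp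
        ultimately show ?thesis using e(2) 2 by blast
      next
        case (3 j)
        with i e \<open>m = 1\<close> show ?thesis by simp
      next
        case (4 i' j)
        then have "j = 1" using \<open>m = 1\<close> by simp
        moreover have "{1..k} \<subseteq> {c (vedge i' 1), c (hedge i' 0), c (hedge i' 1)}"
          using order.trans[OF e(3)[unfolded 4(3)] N_vedge[OF 4(1,2)]] \<open>m = 1\<close> \<open>j = 1\<close> by auto
        ultimately show ?thesis using e(2) 4 by blast
      qed
    next
      show "c (vedge 0 1) \<noteq> c (hedge j 0) \<and> c (vedge 0 1) \<noteq> c (hedge j 1)" if "j \<in> {1..n}" for j
        using that \<open>m = 1\<close> V[of 0 1] H[of j 0] H[of j 1]
        by (intro conjI proper) (auto simp: doubleton_eq_iff)
      show "c (vedge 0 1) \<in> {1..k}" using V[of 0 1] \<open>m = 1\<close> by (intro range) simp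
      show "c (hedge j 0) \<in> {1..k}" if "j \<in> {1..n}" for j
        using H[of j 0] that by (intro range) simp
    qed (rule assms)
    with 2 show ?thesis by simp
  next
    case 3
    show ?thesis
    proof (rule ccontr)
      assume "\<not> k \<le> m + n"
      then have k: "k > m + n" by simp
      have "{1..k} \<subseteq> (\<lambda>i. c (hedge i 0)) ` {1..n} \<union> (\<lambda>j. c (vedge 0 j)) ` {1..m}"
      proof
        fix i assume "i \<in> {1..k}"
        then obtain e where e: "e \<in> edges ?G" "c e = i" "{1..k} \<subseteq> c ` N e" using dom by blast
        from e(1) show "i \<in> (\<lambda>i. c (hedge i 0)) ` {1..n} \<union> (\<lambda>j. c (vedge 0 j)) ` {1..m}"
        proof (cases rule: star_product_edge_cases)
          case (2 i' j)
          \<comment> \<open>Since \<open>m \<ge> 2\<close>, this contradicts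
            \<open>k > m + n\<close>; the other off-centre case uses
            \<open>n \<ge> 2\<close>.\<close>
          have "k \<le> n + 2"
            using le[OF order.trans[OF e(3)[unfolded 2(3)] N_hedge[OF 2(1,2)]]] .
          with 3 k show ?thesis by simp
        next
          case (4 i' j)
          have "k \<le> m + 2"
            using le[OF order.trans[OF e(3)[unfolded 4(3)] N_vedge[OF 4(1,2)]]] .
          with 3 k show ?thesis by simp
        qed (use e(2) in auto)
      qed
      then have "k \<le> card ((\<lambda>i. c (hedge i 0)) ` {1..n} \<union> (\<lambda>j. c (vedge 0 j)) ` {1..m})"
        using card_mono[of _ "{1..k}"] by fastforce
      also have "\<dots> \<le> card ((\<lambda>i. c (hedge i 0)) ` {1..n}) + card ((\<lambda>j. c (vedge 0 j)) ` {1..m})"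
        by (rule card_Un_le)
      also have "\<dots> \<le> n + m"
        using card_image_le[of "{1..n}" "\<lambda>i. c (hedge i 0)"] card_image_le[of "{1..m}" "\<lambda>j. c (vedge 0 j)"]
        by (intro add_mono) auto
      finally show False using k by simp
    qed
  qed
qed

theorem theorem3p2:
  fixes n m :: nat
  assumes "n \<ge> 1" and "m \<ge> 1"
  shows "b_chromatic_number (line_graph (cartesian_product (star_graph n) (star_graph m))) = m + n"
  unfolding b_chromatic_number_def
  using b_coloring_direction_colour b_coloring_star_product_le[OF assms]
  by (intro Greatest_equality) auto

end
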